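(* Let $d\geq 2$ and let $\gamma:\mathbb{R}^d\to\mathbb{R}$ be a gauge with unit ball $B(0,1)=\{x\in\mathbb{R}^d : \gamma(x)\leq 1\}$. The following statements are equivalent: (a) The unit ball $B(0,1)$ is smooth. (b) The gauge $\gamma$ is Gâteaux differentiable on $\mathbb{R}^d\setminus\{0\}$. (c) If $x,y,z\in\mathbb{R}^d$, $x\perp_B y$ and $x\perp_B z$, then $x\perp_B(y+z)$. (d) For every $x,y\in\mathbb{R}^d$, $x\neq 0$, there exists a unique number $\alpha\in\mathbb{R}$ such that $x\perp_B(\alpha x+y)$. (e) For all $x\in\mathbb{R}^d$ with $\gamma(x)=1$, there exists a unique vector $x^\ast\in\mathbb{R}^d$ with $\gamma^\circ(x^\ast)=1$ such that $\langle x^\ast\,|\,x\rangle=1$. In this case, the vector $x^\ast$ in (e) is the Gâteaux derivative of $\gamma$ at $x$ (from (b)); for the number $\alpha$ in (d) one has $\gamma^\prime(x;y)=-\alpha\gamma(x)$; and the unique supporting hyperplane of $B(0,1)$ at one of its boundary points $x$ (from (a)) consists of all points $y$ such that $x\perp_B(y-x)$.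
   Context: A gauge is a function $\gamma:\mathbb{R}^d\to\mathbb{R}$ such that $\gamma(x)\geq 0$ for all $x$, $\gamma(x)=0$ implies $x=0$, $\gamma(\lambda x)=\lambda\gamma(x)$ for all $\lambda>0$, and $\gamma(x+y)\leq\gamma(x)+\gamma(y)$ (it need not be symmetric). $\langle\cdot\,|\,\cdot\rangle$ is the Euclidean inner product. The polar function is $\gamma^\circ(x^\ast)=\inf\{\lambda>0 : \langle x^\ast\,|\,x\rangle\leq\lambda\gamma(x)\text{ for all }x\in\mathbb{R}^d\}$. Birkhoff orthogonality $x\perp_B y$ means $\gamma(x)\leq\gamma(x+\lambda y)$ for all $\lambda\in\mathbb{R}$. $\gamma$ is Gâteaux differentiable at $x$ if the directional derivative $\gamma^\prime(x;y)=\lim_{\lambda\downarrow 0}\frac{\gamma(x+\lambda y)-\gamma(x)}{\lambda}$ is linear in $y$; the Gâteaux derivative at $x$ is then the vector $x^\ast$ with $\gamma^\prime(x;y)=\langle x^\ast\,|\,y\rangle$ for all $y$. For $x^\ast\neq 0$ and $\beta\in\mathbb{R}$, the hyperplane $\{y : \langle x^\ast\,|\,y\rangle=\beta\}$ is a supporting hyperplane of a convex set $B$ if $B$ is contained in the closed half-space $\{y : \langle x^\ast\,|\,y\rangle\leq\beta\}$ but not in its interior. $B$ is smooth if through every boundary point of $B$ there passes a unique supporting hyperplane of $B$. *)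

theory Defs
  imports "HOL-Analysis.Analysis"
begin

(* Unrelated to the constant "gauge" of Henstock-Kurzweil integration. *)
definition gauge_fun :: "('a::real_vector \<Rightarrow> real) \<Rightarrow> bool" where
  "gauge_fun \<gamma> \<longleftrightarrow>
     (\<forall>x. 0 \<le> \<gamma> x) \<and>
     (\<forall>x. \<gamma> x = 0 \<longrightarrow> x = 0) \<and>
     (\<forall>x l. 0 < l \<longrightarrow> \<gamma> (l *\<^sub>R x) = l * \<gamma> x) \<and>
     (\<forall>x y. \<gamma> (x + y) \<le> \<gamma> x + \<gamma> y)"

(* For a gauge on a Euclidean space the set below is nonempty and bounded below,
   so the real-valued Inf is the true infimum. *)
definition polar_fun :: "('a::real_inner \<Rightarrow> real) \<Rightarrow> 'a \<Rightarrow> real" where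
  "polar_fun \<gamma> xs = Inf {l. 0 < l \<and> (\<forall>x. xs \<bullet> x \<le> l * \<gamma> x)}"

definition birkhoff_orth :: "('a::real_vector \<Rightarrow> real) \<Rightarrow> 'a \<Rightarrow> 'a \<Rightarrow> bool" where
  "birkhoff_orth \<gamma> x y \<longleftrightarrow> (\<forall>l::real. \<gamma> x \<le> \<gamma> (x + l *\<^sub>R y))"

definition dir_deriv :: "('a::real_vector \<Rightarrow> real) \<Rightarrow> 'a \<Rightarrow> 'a \<Rightarrow> real" where
  "dir_deriv f x y = Lim (at_right 0) (\<lambda>l. (f (x + l *\<^sub>R y) - f x) / l)"

(* Lim is total, so the existence of the one-sided limits is required separately. *)
definition gateaux_differentiable :: "('a::real_vector \<Rightarrow> real) \<Rightarrow> 'a \<Rightarrow> bool" where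
  "gateaux_differentiable f x \<longleftrightarrow>
     (\<forall>y. \<exists>D. ((\<lambda>l. (f (x + l *\<^sub>R y) - f x) / l) \<longlongrightarrow> D) (at_right 0)) \<and>
     linear (dir_deriv f x)"

definition is_gateaux_derivative :: "('a::real_inner \<Rightarrow> real) \<Rightarrow> 'a \<Rightarrow> 'a \<Rightarrow> bool" where
  "is_gateaux_derivative f x xs \<longleftrightarrow>
     gateaux_differentiable f x \<and> (\<forall>y. dir_deriv f x y = xs \<bullet> y)"

definition supporting_hyperplane :: "'a::real_inner set \<Rightarrow> 'a set \<Rightarrow> bool" where
  "supporting_hyperplane B H \<longleftrightarrow>
     (\<exists>xs b. xs \<noteq> 0 \<and> H = {y. xs \<bullet> y = b} \<and>
        B \<subseteq> {y. xs \<bullet> y \<le> b} \<and> \<not> B \<subseteq> interior {y. xs \<bullet> y \<le> b})"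

(* Uniqueness is that of the hyperplane as a set, not of its normal vector. *)
definition smooth_convex_set :: "'a::real_inner set \<Rightarrow> bool" where
  "smooth_convex_set B \<longleftrightarrow>
     (\<forall>x\<in>frontier B. \<exists>!H. supporting_hyperplane B H \<and> x \<in> H)"

definition gauge_unit_ball :: "('a \<Rightarrow> real) \<Rightarrow> 'a set" where
  "gauge_unit_ball \<gamma> = {x. \<gamma> x \<le> 1}"

end

theory Submission
  imports Defs
begin

text \<open>
  Everything is read off the set of norming functionals \<open>z\<close> of a point \<open>x \<noteq> 0\<close>: those with
  \<open>z \<bullet> y \<le> \<gamma> y\<close> for all \<open>y\<close> and \<open>z \<bullet> x = \<gamma> x\<close>, i.e. the subdifferential of \<open>\<gamma>\<close> at \<open>x\<close>.
  By Hahn-Banach, the values \<open>z \<bullet> y\<close> are exactly the slopes \<open>D\<close> of the affine minorants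
  \<open>l \<mapsto> \<gamma> x + l * D\<close> of \<open>l \<mapsto> \<gamma> (x + l *\<^sub>R y)\<close>; the slope \<open>0\<close> expresses Birkhoff orthogonality,
  and the right derivative is the largest slope. Each of the five conditions then says that
  every \<open>x \<noteq> 0\<close> has just one norming functional.
\<close>

section \<open>Extension of dominated functionals\<close>

text \<open>A hyperplane separating the strict epigraph of \<open>q\<close> from \<open>G\<close>
  contains \<open>G\<close> and is not vertical, so it is the graph of the wanted functional.
  Prescribing values by a subspace of pairs avoids choosing a basis: domination already makes
  \<open>G\<close> single-valued.\<close>

lemma Hahn_Banach_graph:
  fixes q :: "'a::euclidean_space \<Rightarrow> real" and G :: "('a \<times> real) set"
  assumes hom: "\<And>l w. 0 < l \<Longrightarrow> q (l *\<^sub>R w) = l * q w"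
    and sub: "\<And>v w. q (v + w) \<le> q v + q w"
    and G: "subspace G" and dom: "\<And>v t. (v, t) \<in> G \<Longrightarrow> t \<le> q v"
  shows "\<exists>z. (\<forall>w. z \<bullet> w \<le> q w) \<and> (\<forall>v t. (v, t) \<in> G \<longrightarrow> z \<bullet> v = t)"
proof -
  define A where "A = {p. q (fst p) < snd p}"
  have "convex A"
  proof (rule convexI)
    fix p r :: "'a \<times> real" and u v :: real
    assume pr: "p \<in> A" "r \<in> A" and uv: "0 \<le> u" "0 \<le> v" "u + v = 1"
    show "u *\<^sub>R p + v *\<^sub>R r \<in> A"
    proof (cases "u = 0 \<or> v = 0")
      case True
      then show ?thesis using pr uv by auto
    next
      case False
      then have pos: "u > 0" "v > 0" using uv by auto
      have "q (u *\<^sub>R fst p + v *\<^sub>R fst r) \<le> u * q (fst p) + v * q (fst r)"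
        using sub[of "u *\<^sub>R fst p" "v *\<^sub>R fst r"] pos by (simp add: hom)
      also have "\<dots> < u * snd p + v * snd r"
        using pr pos by (intro add_strict_mono) (auto simp: A_def)
      finally show ?thesis by (simp add: A_def)
    qed
  qed
  moreover have "(0, q 0 + 1) \<in> A" by (simp add: A_def)
  moreover have "G \<noteq> {}" "convex G"
    using G subspace_0 subspace_imp_convex by auto
  moreover have "A \<inter> G = {}" using dom by (fastforce simp: A_def)
  ultimately obtain a b where a0: "a \<noteq> 0" and aA: "\<forall>p\<in>A. a \<bullet> p \<le> b" and aG: "\<forall>p\<in>G. b \<le> a \<bullet> p"
    using separating_hyperplane_sets[of A G] by blast
  obtain u s where a: "a = (u, s)" by fastforce
  have le: "u \<bullet> w + s * t \<le> b" if "q w < t" for w t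
    using aA that by (auto simp: A_def a)
  have ge: "b \<le> l * (a \<bullet> p)" if "p \<in> G" for p l
    using aG subspace_scale[OF G that, of l] by fastforce
  have b0: "b \<le> 0" using ge[of _ 0] G subspace_0 by fastforce
  \<comment> \<open>A linear functional bounded below on a subspace vanishes there: otherwise some
    multiple of \<open>p\<close> has the value \<open>b - 1\<close>.\<close>
  have aG0: "a \<bullet> p = 0" if "p \<in> G" for p
  proof (rule ccontr)
    assume "a \<bullet> p \<noteq> 0"
    then show False using ge[OF that, of "(b - 1) / (a \<bullet> p)"] by simp
  qed
  \<comment> \<open>For \<open>s = 0\<close> the hyperplane is vertical, but the epigraph lies over
    every point, so \<open>u \<bullet> u \<le> b \<le> 0\<close>. For \<open>s > 0\<close> heights
    over the origin grow past the bound \<open>b\<close>.\<close>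
  have "s < 0"
  proof (rule ccontr)
    assume s: "\<not> s < 0"
    show False
    proof (cases "s = 0")
      case True
      then have "u \<noteq> 0" using a0 a by (auto simp: zero_prod_def)
      have "u \<bullet> u \<le> b" using le[of u "q u + 1"] True by simp
      then show False using b0 \<open>u \<noteq> 0\<close> by (meson inner_gt_zero_iff less_le_trans not_less)
    next
      case False
      then have "s > 0" using s by simp
      define t where "t = max (q 0 + 1) ((b + 1) / s)"
      have "s * ((b + 1) / s) \<le> s * t" using \<open>s > 0\<close> by (intro mult_left_mono) (auto simp: t_def)
      then have "b + 1 \<le> s * t" using \<open>s > 0\<close> by simp
      moreover have "s * t \<le> b" using le[of 0 t] by (simp add: t_def)
      ultimately show False by simp
    qed
  qed
  define z where "z = (1 / (- s)) *\<^sub>R u"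
  have u: "u = (- s) *\<^sub>R z" using \<open>s < 0\<close> by (simp add: z_def)
  have "z \<bullet> w \<le> q w" for w
  \<comment> \<open>The epigraph is strict, so the separation is applied at height
    \<open>q w + e\<close>.\<close>
  proof (rule field_le_epsilon)
    fix e :: real assume "0 < e"
    have "(- s) * (z \<bullet> w - (q w + e)) \<le> 0"
      using le[of w "q w + e"] \<open>0 < e\<close> b0 by (simp add: u algebra_simps)
    then show "z \<bullet> w \<le> q w + e" using \<open>s < 0\<close> by (simp add: mult_le_0_iff zero_le_mult_iff)
  qed
  moreover have "z \<bullet> v = t" if "(v, t) \<in> G" for v t
  proof -
    have "s * (t - z \<bullet> v) = 0" using aG0[OF that] by (simp add: a u algebra_simps)
    then show ?thesis using \<open>s < 0\<close> by simp
  qed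
  ultimately show ?thesis by blast
qed

section \<open>Norming functionals of a gauge\<close>

locale gauge_function =
  fixes \<gamma> :: "'a::euclidean_space \<Rightarrow> real"
  assumes gauge: "gauge_fun \<gamma>"
begin

lemma nonneg: "0 \<le> \<gamma> x"
  and eq_0D: "\<gamma> x = 0 \<Longrightarrow> x = 0"
  and scale: "0 < l \<Longrightarrow> \<gamma> (l *\<^sub>R x) = l * \<gamma> x"
  and subadd: "\<gamma> (x + y) \<le> \<gamma> x + \<gamma> y"
  using gauge by (auto simp: gauge_fun_def)

lemma zero [simp]: "\<gamma> 0 = 0"
  using scale[of 2 0] by simp

lemma pos: "x \<noteq> 0 \<Longrightarrow> 0 < \<gamma> x"
  using nonneg[of x] eq_0D[of x] by fastforce

definition norming :: "'a \<Rightarrow> 'a set" where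
  "norming x = {z. (\<forall>y. z \<bullet> y \<le> \<gamma> y) \<and> z \<bullet> x = \<gamma> x}"

lemma norming_iff: "z \<in> norming x \<longleftrightarrow> (\<forall>y. z \<bullet> y \<le> \<gamma> y) \<and> z \<bullet> x = \<gamma> x"
  by (simp add: norming_def)

text \<open>The values \<open>\<gamma> x\<close> at \<open>x\<close> and \<open>D\<close> at
  \<open>y\<close> are extended by Hahn-Banach. Taking the span of pairs allows \<open>x\<close> and
  \<open>y\<close> to be linearly dependent.\<close>

lemma slope_iff_norming:
  "(\<forall>l. \<gamma> x + l * D \<le> \<gamma> (x + l *\<^sub>R y)) \<longleftrightarrow> (\<exists>z\<in>norming x. z \<bullet> y = D)"
proof
  assume slope: "\<forall>l. \<gamma> x + l * D \<le> \<gamma> (x + l *\<^sub>R y)"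
  define G where "G = span {(x, \<gamma> x), (y, D)}"
  have dom: "t \<le> \<gamma> v" if "(v, t) \<in> G" for v t
  proof -
    obtain k l where "(v, t) - k *\<^sub>R (x, \<gamma> x) = l *\<^sub>R (y, D)"
      using \<open>(v, t) \<in> G\<close> by (auto simp: G_def span_insert span_singleton)
    then have v: "v = k *\<^sub>R x + l *\<^sub>R y" and t: "t = k * \<gamma> x + l * D"
      by (auto simp: algebra_simps)
    \<comment> \<open>The slope inequality, scaled by \<open>N > 0\<close>, covers
      \<open>N *\<^sub>R x + l *\<^sub>R y\<close>. As \<open>N > k\<close>, this point differs from
      \<open>v\<close> by a positive multiple of \<open>x\<close>, whose cost
      \<open>(N - k) * \<gamma> x\<close> is exactly the surplus on the left.\<close>
    define N where "N = \<bar>k\<bar> + 1"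
    have N: "0 < N" "0 < N - k" by (auto simp: N_def)
    have "N * (\<gamma> x + l / N * D) \<le> N * \<gamma> (x + (l / N) *\<^sub>R y)"
      using slope[rule_format, of "l / N"] N by (intro mult_left_mono) auto
    then have "N * \<gamma> x + l * D \<le> \<gamma> (N *\<^sub>R x + l *\<^sub>R y)"
      using N by (simp add: scale[symmetric] algebra_simps)
    also have "N *\<^sub>R x + l *\<^sub>R y = v + (N - k) *\<^sub>R x"
      by (simp add: v algebra_simps)
    also have "\<gamma> (v + (N - k) *\<^sub>R x) \<le> \<gamma> v + (N - k) * \<gamma> x"
      using subadd N by (metis scale)
    finally show ?thesis by (simp add: t algebra_simps)
  qed
  obtain z where z: "\<forall>w. z \<bullet> w \<le> \<gamma> w" "\<forall>v t. (v, t) \<in> G \<longrightarrow> z \<bullet> v = t"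
    using Hahn_Banach_graph[of \<gamma> G] scale subadd dom by (auto simp: G_def subspace_span)
  have "(x, \<gamma> x) \<in> G" "(y, D) \<in> G" by (auto simp: G_def span_base)
  then have "z \<in> norming x" "z \<bullet> y = D" using z by (auto simp: norming_iff)
  then show "\<exists>z\<in>norming x. z \<bullet> y = D" by blast
next
  assume "\<exists>z\<in>norming x. z \<bullet> y = D"
  then show "\<forall>l. \<gamma> x + l * D \<le> \<gamma> (x + l *\<^sub>R y)"
    by (metis inner_add_right inner_scaleR_right norming_iff)
qed

lemma birkhoff_iff_norming: "birkhoff_orth \<gamma> x y \<longleftrightarrow> (\<exists>z\<in>norming x. z \<bullet> y = 0)"
  using slope_iff_norming[of x 0 y] by (simp add: birkhoff_orth_def)

text \<open>Every \<open>x\<close> is Birkhoff orthogonal to \<open>0\<close>.\<close>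

lemma norming_nonempty: "\<exists>z. z \<in> norming x"
  using birkhoff_iff_norming[of x 0] by (auto simp: birkhoff_orth_def)

lemma norming_scale: "0 < l \<Longrightarrow> norming (l *\<^sub>R x) = norming x"
  by (auto simp: norming_iff scale)

text \<open>The common form to which all five conditions are reduced. The origin is excluded because
  \<open>norming 0\<close> is the whole set of functionals dominated by \<gamma>.\<close>

definition unique_norming :: bool where
  "unique_norming \<longleftrightarrow> (\<forall>x z z'. x \<noteq> 0 \<longrightarrow> z \<in> norming x \<longrightarrow> z' \<in> norming x \<longrightarrow> z = z')"

lemma unique_normingD: "unique_norming \<Longrightarrow> x \<noteq> 0 \<Longrightarrow> z \<in> norming x \<Longrightarrow> z' \<in> norming x \<Longrightarrow> z = z'"
  by (auto simp: unique_norming_def)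

lemma unique_norming_iff_sphere:
  "unique_norming \<longleftrightarrow> (\<forall>x. \<gamma> x = 1 \<longrightarrow> (\<exists>!z. z \<in> norming x))"
proof
  assume "unique_norming"
  then show "\<forall>x. \<gamma> x = 1 \<longrightarrow> (\<exists>!z. z \<in> norming x)"
    using norming_nonempty by (metis unique_norming_def zero zero_neq_one)
next
  assume R: "\<forall>x. \<gamma> x = 1 \<longrightarrow> (\<exists>!z. z \<in> norming x)"
  show "unique_norming" unfolding unique_norming_def
  proof (intro allI impI)
    fix x z z' assume x: "x \<noteq> 0" "z \<in> norming x" "z' \<in> norming x"
    have "\<gamma> ((1 / \<gamma> x) *\<^sub>R x) = 1" "norming ((1 / \<gamma> x) *\<^sub>R x) = norming x"
      using pos[OF x(1)] by (auto simp: scale norming_scale)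
    then show "z = z'" using R x by metis
  qed
qed

section \<open>Continuity and the polar function\<close>

lemma convex_on_gauge: "convex_on UNIV \<gamma>"
proof (intro convex_onI)
  fix t x y assume "0 < t" "t < (1::real)"
  then show "\<gamma> ((1 - t) *\<^sub>R x + t *\<^sub>R y) \<le> (1 - t) * \<gamma> x + t * \<gamma> y"
    using subadd[of "(1 - t) *\<^sub>R x" "t *\<^sub>R y"] by (simp add: scale)
qed simp

lemma continuous_on_gauge: "continuous_on S \<gamma>"
  using convex_on_continuous[OF open_UNIV convex_on_gauge] continuous_on_subset by blast

text \<open>The constant is the minimum of \<gamma> on the compact Euclidean unit sphere.\<close>

lemma norm_bound:
  obtains m where "0 < m" "\<And>y. m * norm y \<le> \<gamma> y"
proof -
  obtain v where v: "norm v = 1" and min: "\<And>u. norm u = 1 \<Longrightarrow> \<gamma> v \<le> \<gamma> u"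
    using continuous_attains_inf[of "sphere 0 1" \<gamma>] continuous_on_gauge
    by (auto simp: dist_norm)
  have "0 < \<gamma> v" using v by (intro pos) auto
  moreover have "\<gamma> v * norm y \<le> \<gamma> y" for y
  proof (cases "y = 0")
    case False
    then have "\<gamma> v \<le> \<gamma> ((1 / norm y) *\<^sub>R y)" by (intro min) simp
    then show ?thesis using False by (simp add: scale field_simps)
  qed simp
  ultimately show ?thesis using that by blast
qed

text \<open>Testing at \<open>x\<close> shows that no admissible factor is below 1, and a norming
  \<open>z\<close> admits 1. Conversely, each quotient \<open>z \<bullet> y / \<gamma> y\<close> is
  a lower bound of the admissible factors, hence at most their infimum 1.\<close>

lemma norming_iff_polar:
  assumes "\<gamma> x = 1"
  shows "z \<in> norming x \<longleftrightarrow> polar_fun \<gamma> z = 1 \<and> z \<bullet> x = 1"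
proof -
  define L where "L = {l. 0 < l \<and> (\<forall>y. z \<bullet> y \<le> l * \<gamma> y)}"
  have polar: "polar_fun \<gamma> z = Inf L" by (simp add: polar_fun_def L_def)
  have "Inf L = 1" if "z \<in> norming x"
  proof (rule cInf_eq_minimum)
    show "1 \<in> L" using that by (auto simp: L_def norming_iff)
    show "1 \<le> l" if "l \<in> L" for l
      using that \<open>z \<in> norming x\<close> assms by (auto simp: L_def norming_iff dest: spec[of _ x])
  qed
  moreover have "z \<bullet> y \<le> \<gamma> y" if "Inf L = 1" for y
  proof (cases "y = 0")
    case False
    have "L \<noteq> {}"
    proof -
      obtain m where m: "0 < m" "\<And>y. m * norm y \<le> \<gamma> y" using norm_bound by blast
      \<comment> \<open>The summand 1 keeps \<open>l\<close> positive even when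
        \<open>z = 0\<close>.\<close>
      define l where "l = (norm z + 1) / m"
      have "0 < l" using m by (auto simp: l_def intro!: divide_pos_pos add_nonneg_pos)
      have "z \<bullet> y \<le> l * \<gamma> y" for y
      proof -
        have "z \<bullet> y \<le> (norm z + 1) * norm y"
          using norm_cauchy_schwarz[of z y] norm_ge_zero[of y] unfolding distrib_right by linarith
        also have "\<dots> = l * (m * norm y)" using m by (simp add: l_def)
        also have "\<dots> \<le> l * \<gamma> y" using m \<open>0 < l\<close> by (intro mult_left_mono) auto
        finally show ?thesis .
      qed
      then show ?thesis using \<open>0 < l\<close> by (auto simp: L_def)
    qed
    have "z \<bullet> y / \<gamma> y \<le> Inf L"
    proof (rule cInf_greatest[OF \<open>L \<noteq> {}\<close>])
      fix l assume "l \<in> L"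
      then show "z \<bullet> y / \<gamma> y \<le> l" using pos[OF False] by (simp add: L_def divide_le_eq)
    qed
    then show ?thesis using that pos[OF False] by (simp add: divide_le_eq)
  qed simp
  ultimately show ?thesis using assms by (auto simp: polar norming_iff)
qed

lemma polar_unique_iff:
  "(\<forall>x. \<gamma> x = 1 \<longrightarrow> (\<exists>!z. polar_fun \<gamma> z = 1 \<and> z \<bullet> x = 1)) \<longleftrightarrow> unique_norming"
  by (simp add: unique_norming_iff_sphere norming_iff_polar cong: imp_cong)

section \<open>Additivity and unique shifts in Birkhoff orthogonality\<close>

lemma birkhoff_shift_iff:
  assumes "x \<noteq> 0"
  shows "birkhoff_orth \<gamma> x (\<alpha> *\<^sub>R x + y) \<longleftrightarrow> (\<exists>z\<in>norming x. z \<bullet> y = - \<alpha> * \<gamma> x)"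
  by (auto simp: birkhoff_iff_norming norming_iff inner_add_right eq_neg_iff_add_eq_0 add.commute)

text \<open>The admissible \<alpha> are the numbers \<open>- (z \<bullet> y) / \<gamma> x\<close>
  with \<open>z\<close> norming \<open>x\<close>; their uniqueness for all \<open>y\<close>
  determines \<open>z\<close>.\<close>

lemma birkhoff_shift_unique_iff:
  "(\<forall>x y. x \<noteq> 0 \<longrightarrow> (\<exists>!\<alpha>. birkhoff_orth \<gamma> x (\<alpha> *\<^sub>R x + y))) \<longleftrightarrow> unique_norming"
proof
  assume L: "\<forall>x y. x \<noteq> 0 \<longrightarrow> (\<exists>!\<alpha>. birkhoff_orth \<gamma> x (\<alpha> *\<^sub>R x + y))"
  show unique_norming unfolding unique_norming_def
  proof (intro allI impI)
    fix x z z' assume x: "x \<noteq> 0" "z \<in> norming x" "z' \<in> norming x"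
    have "z \<bullet> y = z' \<bullet> y" for y
    proof -
      have "birkhoff_orth \<gamma> x ((- (w \<bullet> y) / \<gamma> x) *\<^sub>R x + y)" if "w \<in> norming x" for w
        using that pos[OF x(1)] by (subst birkhoff_shift_iff[OF x(1)]) auto
      then have "- (z \<bullet> y) / \<gamma> x = - (z' \<bullet> y) / \<gamma> x" using L x by blast
      then show ?thesis using pos[OF x(1)] by simp
    qed
    then show "z = z'" by (metis vector_eq_rdot)
  qed
next
  assume U: unique_norming
  show "\<forall>x y. x \<noteq> 0 \<longrightarrow> (\<exists>!\<alpha>. birkhoff_orth \<gamma> x (\<alpha> *\<^sub>R x + y))"
  proof (intro allI impI)
    fix x y :: 'a assume x: "x \<noteq> 0"
    obtain z where z: "z \<in> norming x" using norming_nonempty by blast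
    have "birkhoff_orth \<gamma> x (\<alpha> *\<^sub>R x + y) \<longleftrightarrow> z \<bullet> y = - \<alpha> * \<gamma> x" for \<alpha>
      using birkhoff_shift_iff[OF x] z unique_normingD[OF U x] by metis
    moreover have "z \<bullet> y = - \<alpha> * \<gamma> x \<longleftrightarrow> \<alpha> = - (z \<bullet> y) / \<gamma> x" for \<alpha>
      using pos[OF x] by (auto simp: field_simps)
    ultimately show "\<exists>!\<alpha>. birkhoff_orth \<gamma> x (\<alpha> *\<^sub>R x + y)" by simp
  qed
qed

lemma birkhoff_add_iff:
  "(\<forall>x y z. birkhoff_orth \<gamma> x y \<and> birkhoff_orth \<gamma> x z \<longrightarrow> birkhoff_orth \<gamma> x (y + z))
     \<longleftrightarrow> unique_norming"
proof
  assume L: "\<forall>x y z. birkhoff_orth \<gamma> x y \<and> birkhoff_orth \<gamma> x z \<longrightarrow> birkhoff_orth \<gamma> x (y + z)"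
  show unique_norming unfolding unique_norming_def
  proof (intro allI impI)
    fix x z z' assume x: "x \<noteq> 0" "z \<in> norming x" "z' \<in> norming x"
    have "z \<bullet> w = z' \<bullet> w" for w
    proof -
      \<comment> \<open>Shifting along \<open>x\<close> moves \<open>w\<close> into the kernel of
        \<open>z\<close> and \<open>- w\<close> into the kernel of \<open>z'\<close>. In the sum
        \<open>w\<close> cancels, and a multiple of \<open>x\<close> orthogonal to \<open>x\<close>
        must be zero, so \<open>k = k'\<close>.\<close>
      define k k' where "k = z \<bullet> w / \<gamma> x" and "k' = z' \<bullet> w / \<gamma> x"
      have "z \<bullet> (w - k *\<^sub>R x) = 0" "z' \<bullet> (k' *\<^sub>R x - w) = 0"
        using x pos[OF x(1)] by (simp_all add: norming_iff inner_diff_right k_def k'_def)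
      then have "birkhoff_orth \<gamma> x (w - k *\<^sub>R x)" "birkhoff_orth \<gamma> x (k' *\<^sub>R x - w)"
        unfolding birkhoff_iff_norming using x by blast+
      then have "birkhoff_orth \<gamma> x ((w - k *\<^sub>R x) + (k' *\<^sub>R x - w))" using L by blast
      also have "(w - k *\<^sub>R x) + (k' *\<^sub>R x - w) = (k' - k) *\<^sub>R x" by (simp add: algebra_simps)
      finally have "(k' - k) * \<gamma> x = 0"
        by (auto simp: birkhoff_iff_norming norming_iff)
      then show ?thesis using pos[OF x(1)] by (simp add: k_def k'_def)
    qed
    then show "z = z'" by (metis vector_eq_rdot)
  qed
next
  assume U: unique_norming
  show "\<forall>x y z. birkhoff_orth \<gamma> x y \<and> birkhoff_orth \<gamma> x z \<longrightarrow> birkhoff_orth \<gamma> x (y + z)"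
  proof (intro allI impI)
    fix x y z assume orth: "birkhoff_orth \<gamma> x y \<and> birkhoff_orth \<gamma> x z"
    show "birkhoff_orth \<gamma> x (y + z)"
    \<comment> \<open>The origin lies outside \<open>unique_norming\<close>, but it is orthogonal to
      every vector because \<open>\<gamma> 0 = 0\<close> is the minimum.\<close>
    proof (cases "x = 0")
      case True
      then show ?thesis by (simp add: birkhoff_orth_def nonneg)
    next
      case False
      then show ?thesis
        using orth unique_normingD[OF U False] unfolding birkhoff_iff_norming
        by (metis add_0 inner_add_right)
    qed
  qed
qed

section \<open>One-sided derivatives\<close>

text \<open>By convexity the forward quotients decrease as \<open>l\<close> tends to 0 from the
  right and stay above the backward ones. Their infimum is therefore both the limit and a slope of
  an affine minorant. The resulting \<open>z\<close> may depend on \<open>y\<close>.\<close>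

lemma right_derivative:
  obtains z where "z \<in> norming x"
    "((\<lambda>l. (\<gamma> (x + l *\<^sub>R y) - \<gamma> x) / l) \<longlongrightarrow> z \<bullet> y) (at_right 0)"
proof -
  define f where "f l = (\<gamma> (x + l *\<^sub>R y) - \<gamma> x) / l" for l
  \<comment> \<open>\<open>x\<close> is a convex combination of \<open>x + l *\<^sub>R y\<close> and
    \<open>x - k *\<^sub>R y\<close>; denominators are cleared.\<close>
  have conv: "(k + l) * \<gamma> x \<le> k * \<gamma> (x + l *\<^sub>R y) + l * \<gamma> (x - k *\<^sub>R y)" if "0 < k" "0 < l" for k l
  proof -
    have "(k + l) * \<gamma> x = \<gamma> (k *\<^sub>R (x + l *\<^sub>R y) + l *\<^sub>R (x - k *\<^sub>R y))"
      using scale[of "k + l" x] that by (simp add: algebra_simps)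
    also have "\<dots> \<le> k * \<gamma> (x + l *\<^sub>R y) + l * \<gamma> (x - k *\<^sub>R y)"
      using subadd that by (metis scale)
    finally show ?thesis .
  qed
  have low: "(\<gamma> x - \<gamma> (x - k *\<^sub>R y)) / k \<le> f l" if "0 < k" "0 < l" for k l
    using conv[OF that] that by (simp add: f_def field_simps)
  have mono: "f l \<le> f k" if "0 < l" "l < k" for l k
  proof -
    have "k * \<gamma> (x + l *\<^sub>R y) = \<gamma> ((k - l) *\<^sub>R x + l *\<^sub>R (x + k *\<^sub>R y))"
      using that by (simp add: scale[symmetric] algebra_simps)
    also have "\<dots> \<le> (k - l) * \<gamma> x + l * \<gamma> (x + k *\<^sub>R y)"
      using subadd that by (metis scale diff_gt_0_iff_gt)
    finally show ?thesis using that by (simp add: f_def field_simps)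
  qed
  define D where "D = Inf (f ` {0<..})"
  have bdd: "bdd_below (f ` {0<..})"
    by (rule bdd_belowI[of _ "(\<gamma> x - \<gamma> (x - 1 *\<^sub>R y)) / 1"]) (use low[of 1] in auto)
  have D_le: "D \<le> f l" if "0 < l" for l
    unfolding D_def using bdd that by (intro cInf_lower) auto
  have le_D: "(\<gamma> x - \<gamma> (x - k *\<^sub>R y)) / k \<le> D" if "0 < k" for k
    unfolding D_def by (rule cInf_greatest) (use low that in auto)
  \<comment> \<open>For \<open>l > 0\<close> this is \<open>D \<le> f l\<close>; for
    \<open>l < 0\<close> it says that backward quotients are at most \<open>D\<close>.\<close>
  have "\<gamma> x + l * D \<le> \<gamma> (x + l *\<^sub>R y)" for l
  proof -
    consider "l = 0" | "0 < l" | "l < 0" by linarith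
    then show ?thesis
    proof cases
      case 2 then show ?thesis using D_le[of l] by (simp add: f_def field_simps)
    next
      case 3 then show ?thesis using le_D[of "- l"] by (simp add: field_simps)
    qed simp
  qed
  then obtain z where z: "z \<in> norming x" "z \<bullet> y = D"
    using slope_iff_norming by blast
  have "(f \<longlongrightarrow> D) (at_right 0)"
  proof (rule order_tendstoI)
    fix a assume "a < D"
    have "\<forall>\<^sub>F l in at_right 0. (0::real) < l" by (rule eventually_at_right_less)
    then show "\<forall>\<^sub>F l in at_right 0. a < f l"
      by eventually_elim (use D_le \<open>a < D\<close> in force)
  next
    fix a assume "D < a"
    then obtain k where k: "0 < k" "f k < a"
      unfolding D_def using cInf_lessD[of "f ` {0<..}" a] by auto
    then show "\<forall>\<^sub>F l in at_right 0. f l < a"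
      unfolding eventually_at_right_field using mono by (meson le_less_trans)
  qed
  then show ?thesis using that z by (simp add: f_def[abs_def])
qed

lemma dir_deriv_eqI:
  "((\<lambda>l. (\<gamma> (x + l *\<^sub>R y) - \<gamma> x) / l) \<longlongrightarrow> D) (at_right 0) \<Longrightarrow> dir_deriv \<gamma> x y = D"
  unfolding dir_deriv_def by (rule tendsto_Lim) auto

lemma norming_le_dir_deriv:
  assumes "z \<in> norming x"
  shows "z \<bullet> y \<le> dir_deriv \<gamma> x y"
proof -
  obtain w where lim: "((\<lambda>l. (\<gamma> (x + l *\<^sub>R y) - \<gamma> x) / l) \<longlongrightarrow> w \<bullet> y) (at_right 0)"
    using right_derivative by blast
  have "\<forall>\<^sub>F l in at_right 0. (0::real) < l" by (rule eventually_at_right_less)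
  then have "\<forall>\<^sub>F l in at_right 0. z \<bullet> y \<le> (\<gamma> (x + l *\<^sub>R y) - \<gamma> x) / l"
  proof eventually_elim
    case (elim l)
    have "\<gamma> x + l * (z \<bullet> y) \<le> \<gamma> (x + l *\<^sub>R y)"
      using assms slope_iff_norming by blast
    then show ?case using elim by (simp add: field_simps)
  qed
  then have "z \<bullet> y \<le> w \<bullet> y" using tendsto_lowerbound[OF lim] by simp
  then show ?thesis using dir_deriv_eqI[OF lim] by simp
qed

text \<open>The functional attaining the right derivative could vary with the direction; uniqueness
  makes it \<open>z\<close> in every direction.\<close>

lemma unique_norming_derivative:
  assumes U: unique_norming and x: "x \<noteq> 0" and z: "z \<in> norming x"
  shows "is_gateaux_derivative \<gamma> x z"
proof -
  have lim: "((\<lambda>l. (\<gamma> (x + l *\<^sub>R y) - \<gamma> x) / l) \<longlongrightarrow> z \<bullet> y) (at_right 0)" for y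
  proof -
    obtain w where "w \<in> norming x"
      and "((\<lambda>l. (\<gamma> (x + l *\<^sub>R y) - \<gamma> x) / l) \<longlongrightarrow> w \<bullet> y) (at_right 0)"
      using right_derivative by blast
    then show ?thesis using unique_normingD[OF U x z] by simp
  qed
  then have "dir_deriv \<gamma> x = (\<lambda>y. z \<bullet> y)" by (auto intro: dir_deriv_eqI)
  then show ?thesis
    using lim by (auto simp: is_gateaux_derivative_def gateaux_differentiable_def
        intro!: bounded_linear.linear bounded_linear_inner_right)
qed

lemma gateaux_differentiable_iff:
  "(\<forall>x. x \<noteq> 0 \<longrightarrow> gateaux_differentiable \<gamma> x) \<longleftrightarrow> unique_norming"
proof
  assume L: "\<forall>x. x \<noteq> 0 \<longrightarrow> gateaux_differentiable \<gamma> x"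
  show unique_norming unfolding unique_norming_def
  proof (intro allI impI)
    fix x z z' assume x: "x \<noteq> 0" "z \<in> norming x" "z' \<in> norming x"
    have lin: "linear (dir_deriv \<gamma> x)" using L x by (auto simp: gateaux_differentiable_def)
    \<comment> \<open>Linearity turns the upper bound in direction \<open>- y\<close> into the
      matching lower bound in direction \<open>y\<close>.\<close>
    have "w \<bullet> y = dir_deriv \<gamma> x y" if "w \<in> norming x" for w y
      using norming_le_dir_deriv[OF that, of y] norming_le_dir_deriv[OF that, of "- y"]
      by (simp add: linear_neg[OF lin])
    then show "z = z'" using x by (metis vector_eq_rdot)
  qed
next
  assume unique_norming
  then show "\<forall>x. x \<noteq> 0 \<longrightarrow> gateaux_differentiable \<gamma> x"
    using unique_norming_derivative norming_nonempty
    unfolding is_gateaux_derivative_def by blast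
qed

section \<open>Supporting hyperplanes of the unit ball\<close>

lemma frontier_unit_ball: "frontier (gauge_unit_ball \<gamma>) = {x. \<gamma> x = 1}"
proof -
  have "closed (gauge_unit_ball \<gamma>)"
    unfolding gauge_unit_ball_def
    by (intro closed_Collect_le continuous_on_gauge continuous_on_const)
  moreover have "interior (gauge_unit_ball \<gamma>) = {x. \<gamma> x < 1}"
  proof (rule interior_unique)
    show "open {x. \<gamma> x < 1}"
      by (intro open_Collect_less continuous_on_gauge continuous_on_const)
  next
    fix T assume T: "T \<subseteq> gauge_unit_ball \<gamma>" "open T"
    show "T \<subseteq> {x. \<gamma> x < 1}"
    proof
      fix x assume "x \<in> T"
      \<comment> \<open>An open set in the ball contains, with \<open>x\<close>, some
        \<open>l *\<^sub>R x\<close> with \<open>l > 1\<close>, which forces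
        \<open>\<gamma> x < 1\<close>.\<close>
      have "((\<lambda>l. l *\<^sub>R x) \<longlongrightarrow> 1 *\<^sub>R x) (at_right 1)" by (intro tendsto_intros)
      then have "\<forall>\<^sub>F l in at_right 1. l *\<^sub>R x \<in> T"
        using T \<open>x \<in> T\<close> by (auto dest: topological_tendstoD)
      then have "\<forall>\<^sub>F l in at_right 1. l *\<^sub>R x \<in> T \<and> 1 < l"
        by (intro eventually_conj eventually_at_right_less)
      then obtain l where l: "l *\<^sub>R x \<in> T" "1 < l"
        by (auto dest: eventually_happens)
      then have "l * \<gamma> x \<le> 1"
        using T scale[of l x] by (auto simp: gauge_unit_ball_def)
      moreover have "\<gamma> x < l * \<gamma> x" if "1 \<le> \<gamma> x" using that l by simp
      ultimately show "x \<in> {x. \<gamma> x < 1}" by fastforce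
    qed
  qed (auto simp: gauge_unit_ball_def)
  ultimately have "frontier (gauge_unit_ball \<gamma>) = gauge_unit_ball \<gamma> - {x. \<gamma> x < 1}"
    by (simp add: frontier_def)
  also have "\<dots> = {x. \<gamma> x = 1}" by (force simp: gauge_unit_ball_def)
  finally show ?thesis .
qed

text \<open>Homogeneity turns \<open>w \<bullet> y \<le> b\<close> on the ball into domination by
  \<open>b * \<gamma> y\<close>, so dividing the normal by \<open>b\<close> makes it
  norming.\<close>

lemma supporting_hyperplane_iff_norming:
  assumes "\<gamma> x = 1"
  shows "supporting_hyperplane (gauge_unit_ball \<gamma>) H \<and> x \<in> H
    \<longleftrightarrow> (\<exists>z\<in>norming x. H = {y. z \<bullet> y = 1})"
proof
  assume "supporting_hyperplane (gauge_unit_ball \<gamma>) H \<and> x \<in> H"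
  then obtain w b where w: "w \<noteq> 0" and H: "H = {y. w \<bullet> y = b}" "w \<bullet> x = b"
    and B: "\<And>y. \<gamma> y \<le> 1 \<Longrightarrow> w \<bullet> y \<le> b"
    by (auto simp: supporting_hyperplane_def gauge_unit_ball_def)
  have bound: "w \<bullet> y \<le> b * \<gamma> y" if "y \<noteq> 0" for y
    using B[of "(1 / \<gamma> y) *\<^sub>R y"] pos[OF that] by (simp add: scale field_simps)
  \<comment> \<open>Testing the bound at the normal itself gives \<open>b > 0\<close>.\<close>
  have "0 < w \<bullet> w" using w by simp
  also have "\<dots> \<le> b * \<gamma> w" using bound w by blast
  finally have b: "0 < b" using pos[OF w] by (simp add: zero_less_mult_iff)
  have "((1 / b) *\<^sub>R w) \<bullet> y \<le> \<gamma> y" for y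
    using bound[of y] b by (cases "y = 0") (simp_all add: field_simps)
  then have "(1 / b) *\<^sub>R w \<in> norming x"
    using b H assms by (simp add: norming_iff)
  moreover have "H = {y. ((1 / b) *\<^sub>R w) \<bullet> y = 1}" using b by (auto simp: H)
  ultimately show "\<exists>z\<in>norming x. H = {y. z \<bullet> y = 1}" by blast
next
  assume "\<exists>z\<in>norming x. H = {y. z \<bullet> y = 1}"
  then obtain z where "z \<in> norming x" and H: "H = {y. z \<bullet> y = 1}" by blast
  then have z: "z \<bullet> y \<le> \<gamma> y" "z \<bullet> x = 1" for y
    using assms by (simp_all add: norming_iff)
  have "z \<noteq> 0" using z(2) by auto
  then have "interior {y. z \<bullet> y \<le> 1} = {y. z \<bullet> y < 1}" by (rule interior_halfspace_le)
  then have "\<not> gauge_unit_ball \<gamma> \<subseteq> interior {y. z \<bullet> y \<le> 1}"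
    using z(2) assms by (auto simp: gauge_unit_ball_def dest: subsetD[of _ _ x])
  moreover have "gauge_unit_ball \<gamma> \<subseteq> {y. z \<bullet> y \<le> 1}"
    using order_trans[OF z(1)] by (auto simp: gauge_unit_ball_def)
  moreover have "x \<in> H" using z(2) H by simp
  ultimately show "supporting_hyperplane (gauge_unit_ball \<gamma>) H \<and> x \<in> H"
    using H \<open>z \<noteq> 0\<close> unfolding supporting_hyperplane_def by blast
qed

lemma norming_hyperplane_inject:
  assumes "z \<in> norming x" "z' \<in> norming x" "\<gamma> x = 1" "{y. z \<bullet> y = 1} = {y. z' \<bullet> y = 1}"
  shows "z = z'"
proof -
  have "z \<bullet> w = z' \<bullet> w" for w
  proof -
    \<comment> \<open>Projecting \<open>w\<close> along \<open>x\<close> onto the kernel of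
      \<open>z\<close> and adding \<open>x\<close> gives a point of the common hyperplane.\<close>
    have "z \<bullet> (w - (z \<bullet> w) *\<^sub>R x + x) = 1"
      using assms by (simp add: norming_iff algebra_simps)
    then have "z' \<bullet> (w - (z \<bullet> w) *\<^sub>R x + x) = 1" using assms(4) by blast
    then show ?thesis using assms by (simp add: norming_iff algebra_simps)
  qed
  then show ?thesis by (metis vector_eq_rdot)
qed

text \<open>At a boundary point, sending \<open>z\<close> to its level set at 1 is a bijection from
  norming functionals to supporting hyperplanes.\<close>

lemma smooth_unit_ball_iff: "smooth_convex_set (gauge_unit_ball \<gamma>) \<longleftrightarrow> unique_norming"
proof -
  have "(\<exists>!H. supporting_hyperplane (gauge_unit_ball \<gamma>) H \<and> x \<in> H) \<longleftrightarrow> (\<exists>!z. z \<in> norming x)"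
    if "\<gamma> x = 1" for x
  proof -
    define h where "h z = {y. z \<bullet> y = 1}" for z :: 'a
    have inj: "inj_on h (norming x)"
      using norming_hyperplane_inject[OF _ _ that] unfolding inj_on_def h_def by blast
    have "(\<exists>!H. H \<in> h ` norming x) \<longleftrightarrow> (\<exists>!z. z \<in> norming x)"
    proof
      assume "\<exists>!H. H \<in> h ` norming x"
      then have "h z = h z'" if "z \<in> norming x" "z' \<in> norming x" for z z'
        using that by blast
      then show "\<exists>!z. z \<in> norming x"
        using inj_onD[OF inj] norming_nonempty[of x] by blast
    next
      assume "\<exists>!z. z \<in> norming x"
      then show "\<exists>!H. H \<in> h ` norming x" by blast
    qed
    then show ?thesis
      unfolding supporting_hyperplane_iff_norming[OF that] by (simp add: image_iff h_def)
  qed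
  then show ?thesis
    by (auto simp: smooth_convex_set_def frontier_unit_ball unique_norming_iff_sphere)
qed

end

theorem theorem3p18:
  fixes \<gamma> :: "real ^ 'n \<Rightarrow> real"
  assumes "CARD('n) \<ge> 2"
    and "gauge_fun \<gamma>"
  defines "a \<equiv> smooth_convex_set (gauge_unit_ball \<gamma>)"
    and "b \<equiv> \<forall>x. x \<noteq> 0 \<longrightarrow> gateaux_differentiable \<gamma> x"
    and "c \<equiv> \<forall>x y z. birkhoff_orth \<gamma> x y \<and> birkhoff_orth \<gamma> x z \<longrightarrow> birkhoff_orth \<gamma> x (y + z)"
    and "d \<equiv> \<forall>x y. x \<noteq> 0 \<longrightarrow> (\<exists>!\<alpha>::real. birkhoff_orth \<gamma> x (\<alpha> *\<^sub>R x + y))"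
    and "e \<equiv> \<forall>x. \<gamma> x = 1 \<longrightarrow> (\<exists>!xs. polar_fun \<gamma> xs = 1 \<and> xs \<bullet> x = 1)"
  shows "(a \<longleftrightarrow> b) \<and> (a \<longleftrightarrow> c) \<and> (a \<longleftrightarrow> d) \<and> (a \<longleftrightarrow> e) \<and>
    (a \<longrightarrow>
      (\<forall>x xs. \<gamma> x = 1 \<and> polar_fun \<gamma> xs = 1 \<and> xs \<bullet> x = 1 \<longrightarrow> is_gateaux_derivative \<gamma> x xs) \<and>
      (\<forall>x y \<alpha>. x \<noteq> 0 \<and> birkhoff_orth \<gamma> x (\<alpha> *\<^sub>R x + y) \<longrightarrow> dir_deriv \<gamma> x y = - \<alpha> * \<gamma> x) \<and>
      (\<forall>x\<in>frontier (gauge_unit_ball \<gamma>). \<forall>H.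
         supporting_hyperplane (gauge_unit_ball \<gamma>) H \<and> x \<in> H \<longrightarrow>
         H = {y. birkhoff_orth \<gamma> x (y - x)}))"
proof -
  interpret gauge_function \<gamma> by standard (rule assms(2))
  have eqv: "a \<longleftrightarrow> unique_norming" "b \<longleftrightarrow> unique_norming" "c \<longleftrightarrow> unique_norming"
    "d \<longleftrightarrow> unique_norming" "e \<longleftrightarrow> unique_norming"
    unfolding a_def b_def c_def d_def e_def
    by (rule smooth_unit_ball_iff gateaux_differentiable_iff birkhoff_add_iff
        birkhoff_shift_unique_iff polar_unique_iff)+
  have "is_gateaux_derivative \<gamma> x xs"
    if unique_norming "\<gamma> x = 1" "polar_fun \<gamma> xs = 1" "xs \<bullet> x = 1" for x xs
    using that norming_iff_polar[of x xs] by (intro unique_norming_derivative) auto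
  moreover have "dir_deriv \<gamma> x y = - \<alpha> * \<gamma> x"
    if U: unique_norming and x: "x \<noteq> 0" and orth: "birkhoff_orth \<gamma> x (\<alpha> *\<^sub>R x + y)" for x y \<alpha>
  proof -
    obtain z where "z \<in> norming x" "z \<bullet> y = - \<alpha> * \<gamma> x"
      using birkhoff_shift_iff[OF x] orth by blast
    then show ?thesis
      using unique_norming_derivative[OF U x] by (auto simp: is_gateaux_derivative_def)
  qed
  moreover have "H = {y. birkhoff_orth \<gamma> x (y - x)}"
    if U: unique_norming and "x \<in> frontier (gauge_unit_ball \<gamma>)"
      and H: "supporting_hyperplane (gauge_unit_ball \<gamma>) H \<and> x \<in> H" for x H
  proof -
    have x: "\<gamma> x = 1" "x \<noteq> 0" using that by (auto simp: frontier_unit_ball)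
    then obtain z where z: "z \<in> norming x" "H = {y. z \<bullet> y = 1}"
      using H supporting_hyperplane_iff_norming by blast
    \<comment> \<open>With \<open>z\<close> the only norming functional, orthogonality to
      \<open>y - x\<close> is one linear equation, namely that of \<open>H\<close>.\<close>
    have "birkhoff_orth \<gamma> x (y - x) \<longleftrightarrow> z \<bullet> (y - x) = 0" for y
      using birkhoff_iff_norming z unique_normingD[OF U x(2)] by metis
    then show ?thesis using z x by (auto simp: norming_iff inner_diff_right)
  qed
  ultimately show ?thesis by (simp add: eqv)
qed

end
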